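(* Let $n>2$, let $k\in\{1,\dots,n\}$ and $f_k=(e_1+\cdots+e_k)/k$. Consider a second order Markov chain on $\{1,\dots,n\}$ with transition tensor $P=(p_{i,i_1,i_2})$, and let $P_i=(p_{r,i,s})_{1\le r,s\le n}$ for $i=1,\dots,n$. If every column of $P_i$ equals $f_k$ for every $i=1,\dots,n$ (call this the base chain for $k$), then $f_k$ is the only stationary vector of the Markov chain. Moreover: (1) If $k=2$ and, in the base chain for $k$, one replaces the first column of $P_1$ by $e_1$ and all the columns of $P_2$ by $e_2$, then the resulting Markov chain has exactly 2 stationary vectors, namely $e_1$ and $e_2$. (2) If $2<k\le n$ and, in the base chain for $k$, for each $i=1,\dots,k$ one replaces the $i$th column of $P_i$ by $e_i$ and all other columns of $P_i$ by $e_k$, then the resulting Markov chain has exactly $k$ stationary vectors, namely $e_1,\dots,e_k$. (3) If $k=n$ and, in the base chain for $k=n$, one replaces the $i$th column of $P_i$ by $e_i$ for all $i=1,\dots,n$, then the resulting Markov chain has exactly $n+1$ stationary vectors, namely $e_1,\dots,e_n$ and $f_n$. (4) If $k\in\{2,\dots,n-1\}$ and, in the base chain for $k$, one replaces each of the first $k$ columns of $P_i$ by $e_i$ for $i=1,\dots,k$, then the set of stationary vectors of the resulting Markov chain equals $\operatorname{conv}\{e_1,\dots,e_k\}$. (5) Suppose $k\in\{2,\dots,n-1\}$ and the matrices $P_1,\dots,P_n$ are reset so that, for each $i=1,\dots,n$, each of the first $k$ columns of $P_i$ equals $$v_i=\begin{cases}e_i & \text{if } i=1,\dots,k,\\ (e_{k+1}+\cdots+e_n)/(n-k)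 & \text{if } i=k+1,\dots,n,\end{cases}$$ and all other columns of $P_i$ equal $f_n=(e_1+\cdots+e_n)/n$. Then the set of stationary vectors of the Markov chain equals $\{f_n\}\cup\operatorname{conv}\{e_1,\dots,e_k\}$.
   Context: $\Omega_n=\{\mathbf{x}=(x_1,\dots,x_n)^t\in\mathbf{R}^n: x_1,\dots,x_n\ge 0,\ \sum_{i=1}^n x_i=1\}$. $e_1,\dots,e_n$ is the standard basis of $\mathbf{R}^n$; $\operatorname{conv}$ denotes convex hull. The transition tensor of a second order Markov chain is a real array $P=(p_{i,i_1,i_2})_{1\le i,i_1,i_2\le n}$ with nonnegative entries and $\sum_{i=1}^n p_{i,i_1,i_2}=1$ for all $i_1,i_2$. It is determined by the column stochastic matrices $P_i=(p_{r,i,s})_{1\le r,s\le n}$, $i=1,\dots,n$ ($r$ the row index, $s$ the column index). A vector $\mathbf{x}\in\Omega_n$ is a stationary vector if $\mathbf{x}=(x_1P_1+\cdots+x_nP_n)\mathbf{x}$. *)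

theory Defs
  imports "HOL-Analysis.Analysis"
begin

text \<open>
  The state space is an arbitrary finite type \<open>'n\<close>. The numbering of the states by
  \<open>1, \<dots>, n\<close>, where \<open>n = CARD('n)\<close>, is an explicit bijection \<open>en\<close>, so the standard basis vector
  with number \<open>j\<close> is \<open>ebasis (en j)\<close>.
\<close>

type_synonym 'n tensor = "'n \<Rightarrow> 'n \<Rightarrow> 'n \<Rightarrow> real"

abbreviation ebasis :: "'n::finite \<Rightarrow> real ^ 'n" where
  "ebasis i \<equiv> axis i 1"

definition prob_simplex :: "(real ^ 'n::finite) set" where
  "prob_simplex = {x. (\<forall>i. 0 \<le> x $ i) \<and> (\<Sum>i\<in>UNIV. x $ i) = 1}"

definition transition_tensor :: "'n::finite tensor \<Rightarrow> bool" where
  "transition_tensor P \<longleftrightarrow>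
     (\<forall>i i1 i2. 0 \<le> P i i1 i2) \<and> (\<forall>i1 i2. (\<Sum>i\<in>UNIV. P i i1 i2) = 1)"

text \<open>The matrix \<open>P\<^sub>i\<close> fixes the middle index; \<open>r\<close> is the row and \<open>s\<close> the column.\<close>

definition slice :: "'n::finite tensor \<Rightarrow> 'n \<Rightarrow> real ^ 'n ^ 'n" where
  "slice P i = (\<chi> r s. P r i s)"

definition stationary_vectors :: "'n::finite tensor \<Rightarrow> (real ^ 'n) set" where
  "stationary_vectors P =
     {x \<in> prob_simplex. x = (\<Sum>i\<in>UNIV. x $ i *\<^sub>R slice P i) *v x}"

text \<open>For every \<open>(i, s) \<in> A\<close>, column \<open>s\<close> of the matrix \<open>P\<^sub>i\<close> is replaced by the vector \<open>c i s\<close>.\<close>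

definition replace_columns ::
  "'n::finite tensor \<Rightarrow> ('n \<times> 'n) set \<Rightarrow> ('n \<Rightarrow> 'n \<Rightarrow> real ^ 'n) \<Rightarrow> 'n tensor" where
  "replace_columns P A c = (\<lambda>r i s. if (i, s) \<in> A then c i s $ r else P r i s)"

definition fvec :: "(nat \<Rightarrow> 'n::finite) \<Rightarrow> nat \<Rightarrow> real ^ 'n" where
  "fvec en k = (\<Sum>j=1..k. ebasis (en j)) /\<^sub>R real k"

end

theory Submission
  imports Defs
begin

text \<open>
  In coordinates, \<open>x\<close> is stationary iff \<open>x\<^sub>r = (\<Sum>i. \<Sum>s. x\<^sub>i x\<^sub>s p\<^sub>r\<^sub>i\<^sub>s)\<close> for all \<open>r\<close>. Since the
  coordinates of \<open>x\<close> sum to 1, columns that all equal \<open>u\<close> contribute exactly \<open>u\<^sub>r\<close>, so replacing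
  the columns in \<open>A\<close> by vectors \<open>c i s\<close> leaves the equations
  \<open>x\<^sub>r = u\<^sub>r + (\<Sum>(i, s)\<in>A. x\<^sub>i x\<^sub>s (c\<^sub>i\<^sub>s\<^sub>r - u\<^sub>r))\<close> (lemma \<open>stationary_replace_iff\<close>). With \<open>A\<close> empty
  this is \<open>x = u\<close>. Let \<open>K\<close> be the set of the first \<open>k\<close> states. In (1), (2) and (4) every column
  vanishes off \<open>K\<close>, hence so does every stationary vector (\<open>stationary_vanishes\<close>), and the system
  becomes elementary.

  In (1), \<open>K\<close> has two states and the equation for the first is \<open>x\<^sub>1 = (x\<^sub>1\<^sup>2 + x\<^sub>1) / 2\<close>, so
  \<open>x\<^sub>1\<close> is 0 or 1. In (2), the equations for the states other than the \<open>k\<close>-th are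
  \<open>x\<^sub>r = x\<^sub>r\<^sup>2\<close>, so again all coordinates are 0 or 1. In (4) all equations hold identically on the
  face of the simplex spanned by \<open>K\<close>, and this face is the convex hull of its vertices.

  In (3) the equations are \<open>x\<^sub>r - x\<^sub>r\<^sup>2 = c\<close> with the same \<open>c\<close> for all \<open>r\<close>. Two different
  coordinates are then the two roots \<open>a\<close> and \<open>1 - a\<close> of this quadratic equation. As they already
  sum to 1, a third coordinate is 0, which forces \<open>c = 0\<close> and a vertex. Otherwise all coordinates
  agree. In (5), with \<open>t\<close> the total mass of \<open>x\<close> on \<open>K\<close>, the equation for \<open>r \<in> K\<close> is
  \<open>(1 - t) (x\<^sub>r - 1/n) = 0\<close>. Either \<open>t = 1\<close>, which is the face spanned by \<open>K\<close>, or \<open>x\<^sub>r = 1/n\<close> on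
  \<open>K\<close>, which gives \<open>t = k/n\<close>, and the remaining equations then give \<open>x\<^sub>r = 1/n\<close> off \<open>K\<close> as well.
\<close>

section \<open>The simplex and its faces\<close>

lemma ebasis_in_prob_simplex: "ebasis j \<in> prob_simplex"
  by (auto simp: prob_simplex_def axis_def)

lemma prob_simplex_sum: "x \<in> prob_simplex \<Longrightarrow> (\<Sum>i\<in>UNIV. x $ i) = 1"
  by (simp add: prob_simplex_def)

lemma prob_simplex_nonneg: "x \<in> prob_simplex \<Longrightarrow> 0 \<le> x $ i"
  by (simp add: prob_simplex_def)

lemma eq_ebasis_if_coordinate_1:
  assumes x: "x \<in> prob_simplex" and j: "x $ j = 1"
  shows "x = ebasis j"
proof -
  have "(\<Sum>i\<in>UNIV. x $ i) = x $ j + (\<Sum>i\<in>UNIV - {j}. x $ i)"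
    by (simp add: sum.remove)
  hence "(\<Sum>i\<in>UNIV - {j}. x $ i) = 0"
    using prob_simplex_sum[OF x] j by simp
  hence "x $ i = 0" if "i \<noteq> j" for i
    using that prob_simplex_nonneg[OF x] by (subst (asm) sum_nonneg_eq_0_iff) auto
  thus ?thesis
    using j by (auto simp: vec_eq_iff axis_def)
qed

lemma eq_ebasis_if_coordinates_0_1:
  assumes x: "x \<in> prob_simplex" and 01: "\<And>r. x $ r = 0 \<or> x $ r = 1"
  obtains j where "x = ebasis j"
proof -
  have "\<exists>j. x $ j \<noteq> 0"
    using prob_simplex_sum[OF x] by (metis sum.neutral zero_neq_one)
  thus ?thesis
    using 01 eq_ebasis_if_coordinate_1[OF x] that by metis
qed

lemma sum_prob_simplex_face:
  assumes "x \<in> prob_simplex" and "\<And>r. r \<notin> K \<Longrightarrow> x $ r = 0"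
  shows "(\<Sum>i\<in>K. x $ i) = 1"
  using assms sum.mono_neutral_left[of UNIV K "\<lambda>i. x $ i"] prob_simplex_sum by fastforce

lemma convex_hull_ebasis:
  "convex hull (ebasis ` K) = {x \<in> prob_simplex. \<forall>r. r \<notin> K \<longrightarrow> x $ r = 0}"
    (is "_ = ?F")
proof
  have "convex ?F"
    unfolding convex_def prob_simplex_def
    by (auto simp: sum.distrib simp flip: sum_distrib_left)
  moreover have "ebasis ` K \<subseteq> ?F"
    using ebasis_in_prob_simplex by (auto simp: axis_def)
  ultimately show "convex hull (ebasis ` K) \<subseteq> ?F"
    by (simp add: hull_minimal)
next
  show "?F \<subseteq> convex hull (ebasis ` K)"
  proof
    fix x assume "x \<in> ?F"
    hence x: "x \<in> prob_simplex" and off: "\<And>r. r \<notin> K \<Longrightarrow> x $ r = 0"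
      by auto
    have "(\<Sum>i\<in>K. x $ i *\<^sub>R ebasis i) \<in> convex hull (ebasis ` K)"
      using sum_prob_simplex_face[OF x off] prob_simplex_nonneg[OF x]
      by (intro convex_sum) (auto intro: hull_inc)
    moreover have "(\<Sum>i\<in>K. x $ i *\<^sub>R ebasis i) = x"
      using off by (auto simp: vec_eq_iff axis_def if_distrib sum.delta cong: if_cong)
    ultimately show "x \<in> convex hull (ebasis ` K)"
      by simp
  qed
qed

text \<open>
  The vectors \<open>f\<^sub>k\<close> and \<open>v\<^sub>i\<close> are means of standard basis vectors. Describing them by the set of
  states that carries the mass removes the enumeration of the states from the analysis of the
  chains.
\<close>
definition uniform_on :: "'n::finite set \<Rightarrow> real ^ 'n" where
  "uniform_on K = (\<chi> r. if r \<in> K then 1 / real (card K) else 0)"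

lemma uniform_on_nth [simp]:
  "uniform_on K $ r = (if r \<in> K then 1 / real (card K) else 0)"
  by (simp add: uniform_on_def)

lemma uniform_on_in_prob_simplex: "K \<noteq> {} \<Longrightarrow> uniform_on K \<in> prob_simplex"
  by (auto simp: prob_simplex_def sum.If_cases)

lemma mean_of_ebasis_eq_uniform_on:
  assumes "inj_on en J"
  shows "(\<Sum>j\<in>J. ebasis (en j)) /\<^sub>R real (card J) = uniform_on (en ` J)"
proof -
  have "(\<Sum>j\<in>J. ebasis (en j)) = (\<Sum>i\<in>en ` J. ebasis i)"
    using assms by (simp add: sum.reindex)
  thus ?thesis
    using assms by (auto simp: vec_eq_iff axis_def card_image divide_inverse if_distrib sum.delta
        cong: if_cong)
qed

section \<open>Stationary vectors after replacing columns\<close>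

definition constant_tensor :: "real ^ 'n \<Rightarrow> 'n::finite tensor" where
  "constant_tensor u = (\<lambda>r i s. u $ r)"

lemma transition_tensor_replace_columns:
  assumes "transition_tensor P" and "\<And>i s. (i, s) \<in> A \<Longrightarrow> c i s \<in> prob_simplex"
  shows "transition_tensor (replace_columns P A c)"
  unfolding transition_tensor_def
proof (intro conjI allI)
  show "0 \<le> replace_columns P A c r i s" for r i s
    using assms prob_simplex_nonneg by (auto simp: transition_tensor_def replace_columns_def)
  show "(\<Sum>r\<in>UNIV. replace_columns P A c r i s) = 1" for i s
    using assms prob_simplex_sum[of "c i s"]
    by (cases "(i, s) \<in> A") (auto simp: transition_tensor_def replace_columns_def)
qed

lemma replace_columns_twice:
  "replace_columns (replace_columns P A c) B d =
   replace_columns P (A \<union> B) (\<lambda>i s. if (i, s) \<in> B then d i s else c i s)"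
  by (auto simp: replace_columns_def fun_eq_iff)

lemma stationary_iff:
  "x \<in> stationary_vectors P \<longleftrightarrow>
   x \<in> prob_simplex \<and> (\<forall>r. x $ r = (\<Sum>i\<in>UNIV. \<Sum>s\<in>UNIV. x $ i * x $ s * P r i s))"
proof -
  have "((\<Sum>i\<in>UNIV. x $ i *\<^sub>R slice P i) *v x) $ r =
        (\<Sum>i\<in>UNIV. \<Sum>s\<in>UNIV. x $ i * x $ s * P r i s)" for r
  proof -
    have "((\<Sum>i\<in>UNIV. x $ i *\<^sub>R slice P i) *v x) $ r =
          (\<Sum>s\<in>UNIV. \<Sum>i\<in>UNIV. x $ i * x $ s * P r i s)"
      by (simp add: matrix_vector_mult_def slice_def sum_distrib_left mult_ac)
    also have "\<dots> = (\<Sum>i\<in>UNIV. \<Sum>s\<in>UNIV. x $ i * x $ s * P r i s)"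
      by (rule sum.swap)
    finally show ?thesis .
  qed
  thus ?thesis
    by (auto simp: stationary_vectors_def vec_eq_iff)
qed

lemma stationary_in_prob_simplex: "x \<in> stationary_vectors P \<Longrightarrow> x \<in> prob_simplex"
  by (simp add: stationary_vectors_def)

lemma stationary_vanishes:
  assumes "x \<in> stationary_vectors P" and "\<And>i s. P r i s = 0"
  shows "x $ r = 0"
proof -
  have "x $ r = (\<Sum>i\<in>UNIV. \<Sum>s\<in>UNIV. x $ i * x $ s * P r i s)"
    using assms(1) unfolding stationary_iff by blast
  also have "\<dots> = 0"
    by (simp add: assms(2))
  finally show ?thesis .
qed

text \<open>
  The constant part of the tensor contributes \<open>u\<^sub>r (\<Sum>i. x\<^sub>i)\<^sup>2 = u\<^sub>r\<close>, so only the deviations of the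
  replaced columns from \<open>u\<close> remain.
\<close>
lemma stationary_replace_iff:
  "x \<in> stationary_vectors (replace_columns (constant_tensor u) A c) \<longleftrightarrow>
   x \<in> prob_simplex \<and>
   (\<forall>r. x $ r = u $ r + (\<Sum>(i, s)\<in>A. x $ i * x $ s * (c i s $ r - u $ r)))"
proof -
  have "(\<Sum>i\<in>UNIV. \<Sum>s\<in>UNIV. x $ i * x $ s * replace_columns (constant_tensor u) A c r i s) =
        u $ r + (\<Sum>(i, s)\<in>A. x $ i * x $ s * (c i s $ r - u $ r))"
    if x: "x \<in> prob_simplex" for r
  proof -
    have "(\<Sum>i\<in>UNIV. \<Sum>s\<in>UNIV. x $ i * x $ s * replace_columns (constant_tensor u) A c r i s) =
          (\<Sum>(i, s)\<in>UNIV. x $ i * x $ s * u $ r +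
             (if (i, s) \<in> A then x $ i * x $ s * (c i s $ r - u $ r) else 0))"
      by (auto simp: sum.cartesian_product replace_columns_def constant_tensor_def algebra_simps
          intro!: sum.cong)
    also have "\<dots> = (\<Sum>i\<in>UNIV. \<Sum>s\<in>UNIV. x $ i * x $ s * u $ r) +
             (\<Sum>p\<in>UNIV. if p \<in> A then (case p of (i, s) \<Rightarrow> x $ i * x $ s * (c i s $ r - u $ r)) else 0)"
      by (simp add: sum.distrib sum.cartesian_product split_def cong: if_cong)
    also have "(\<Sum>i\<in>UNIV. \<Sum>s\<in>UNIV. x $ i * x $ s * u $ r) = u $ r"
      using prob_simplex_sum[OF x] by (simp flip: sum_distrib_left sum_distrib_right)
    finally show ?thesis
      by (simp add: sum.If_cases)
  qed
  thus ?thesis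
    unfolding stationary_iff by (metis (no_types, lifting))
qed

lemma stationary_constant:
  assumes "u \<in> prob_simplex"
  shows "stationary_vectors (constant_tensor u) = {u}"
proof -
  have "replace_columns (constant_tensor u) {} (\<lambda>i s. u) = constant_tensor u"
    by (simp add: replace_columns_def)
  hence "x \<in> stationary_vectors (constant_tensor u) \<longleftrightarrow> x \<in> prob_simplex \<and> (\<forall>r. x $ r = u $ r)" for x
    using stationary_replace_iff[of x u "{}" "\<lambda>i s. u"] by simp
  thus ?thesis
    using assms by (auto simp: vec_eq_iff)
qed

section \<open>Chains with finitely many stationary vectors\<close>

text \<open>
  A stationary vector has all its mass on \<open>{a, b}\<close>, so one equation suffices. State \<open>a\<close> receives
  \<open>x\<^sub>a\<^sup>2\<close> from the absorbing pair \<open>(a, a)\<close> and half of \<open>x\<^sub>a x\<^sub>b\<close> from the pair \<open>(a, b)\<close>, which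
  is less than the required \<open>x\<^sub>a = x\<^sub>a\<^sup>2 + x\<^sub>a x\<^sub>b\<close> unless \<open>x\<^sub>a x\<^sub>b = 0\<close>.
\<close>
lemma stationary_two_vertices:
  assumes "a \<noteq> b"
  shows "stationary_vectors
           (replace_columns
             (replace_columns (constant_tensor (uniform_on {a, b})) {(a, a)} (\<lambda>i s. ebasis a))
             ({b} \<times> UNIV) (\<lambda>i s. ebasis b)) = {ebasis a, ebasis b}"
    (is "stationary_vectors ?Q = _")
proof -
  let ?u = "uniform_on {a, b} :: real ^ 'a"
  let ?A = "{(a, a)} \<union> {b} \<times> UNIV"
  let ?c = "\<lambda>i s. if (i, s) \<in> {b} \<times> UNIV then ebasis b else ebasis a :: real ^ 'a"
  have Q: "?Q = replace_columns (constant_tensor ?u) ?A ?c"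
    by (simp add: replace_columns_twice)
  have deviation: "(\<Sum>(i, s)\<in>?A. x $ i * x $ s * (?c i s $ r - ?u $ r)) =
      (x $ a)\<^sup>2 * (ebasis a $ r - ?u $ r) + x $ b * (ebasis b $ r - ?u $ r)"
    if x: "x \<in> prob_simplex" for x r
  proof -
    have "(\<Sum>(i, s)\<in>?A. x $ i * x $ s * (?c i s $ r - ?u $ r)) =
      (\<Sum>(i, s)\<in>{(a, a)}. x $ i * x $ s * (?c i s $ r - ?u $ r)) +
      (\<Sum>(i, s)\<in>{b} \<times> UNIV. x $ i * x $ s * (?c i s $ r - ?u $ r))"
      using assms by (intro sum.union_disjoint) auto
    also have "(\<Sum>(i, s)\<in>{b} \<times> UNIV. x $ i * x $ s * (?c i s $ r - ?u $ r)) =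
      x $ b * (ebasis b $ r - ?u $ r) * (\<Sum>s\<in>UNIV. x $ s)"
      by (simp add: sum_distrib_left sum_distrib_right mult_ac flip: sum.cartesian_product
            del: uniform_on_nth)
    finally show ?thesis
      using assms prob_simplex_sum[OF x] by (simp add: power2_eq_square del: uniform_on_nth)
  qed
  have stat_iff: "x \<in> stationary_vectors ?Q \<longleftrightarrow> x \<in> prob_simplex \<and>
      (\<forall>r. x $ r = ?u $ r +
        ((x $ a)\<^sup>2 * (ebasis a $ r - ?u $ r) + x $ b * (ebasis b $ r - ?u $ r)))" for x
    by (simp only: Q stationary_replace_iff deviation cong: conj_cong)
  show ?thesis
  proof (intro set_eqI iffI)
    fix x assume stat: "x \<in> stationary_vectors ?Q"
    hence x: "x \<in> prob_simplex"
      by (rule stationary_in_prob_simplex)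
    have "x $ r = 0" if "r \<notin> {a, b}" for r
      using stat that
      by (intro stationary_vanishes[OF stat])
        (auto simp: replace_columns_def constant_tensor_def axis_def)
    hence ab: "x $ a + x $ b = 1"
      using sum_prob_simplex_face[OF x, of "{a, b}"] assms by simp
    have "x $ a = ?u $ a + ((x $ a)\<^sup>2 * (ebasis a $ a - ?u $ a) + x $ b * (ebasis b $ a - ?u $ a))"
      using stat unfolding stat_iff by blast
    also have "\<dots> = 1 / 2 + (x $ a)\<^sup>2 / 2 - x $ b / 2"
      using assms by (simp add: axis_def)
    finally have "x $ a = 1 / 2 + (x $ a)\<^sup>2 / 2 - x $ b / 2" .
    hence "x $ a - (x $ a)\<^sup>2 = 0"
      using ab by linarith
    hence "x $ a * (1 - x $ a) = 0"
      by (simp add: power2_eq_square right_diff_distrib)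
    hence "x $ a = 1 \<or> x $ b = 1"
      using ab by auto
    thus "x \<in> {ebasis a, ebasis b}"
      using eq_ebasis_if_coordinate_1[OF x] by auto
  next
    fix x :: "real ^ 'a" assume x_eq: "x \<in> {ebasis a, ebasis b}"
    hence x: "x \<in> prob_simplex"
      using ebasis_in_prob_simplex by auto
    have "x $ r = ?u $ r + ((x $ a)\<^sup>2 * (ebasis a $ r - ?u $ r) + x $ b * (ebasis b $ r - ?u $ r))" for r
      using x_eq assms by (auto simp: axis_def)
    thus "x \<in> stationary_vectors ?Q"
      unfolding stat_iff using x by blast
  qed
qed

text \<open>
  A stationary vector has all its mass on \<open>K\<close>, where every pair of distinct states moves to \<open>b\<close>.
  A state \<open>r \<noteq> b\<close> in \<open>K\<close> therefore receives mass only from the pair \<open>(r, r)\<close>, and stationarity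
  at \<open>r\<close> reads \<open>x\<^sub>r = x\<^sub>r\<^sup>2\<close>.
\<close>
lemma stationary_vertices:
  assumes b: "b \<in> K"
  shows "stationary_vectors
           (replace_columns (constant_tensor (uniform_on K)) (K \<times> UNIV)
             (\<lambda>i s. if s = i then ebasis i else ebasis b)) = ebasis ` K"
    (is "stationary_vectors ?Q = _")
proof -
  let ?u = "uniform_on K :: real ^ 'a"
  let ?c = "\<lambda>i s. if s = i then ebasis i else ebasis b :: real ^ 'a"
  have deviation: "?u $ r + (\<Sum>(i, s)\<in>K \<times> UNIV. x $ i * x $ s * (?c i s $ r - ?u $ r)) =
      (\<Sum>i\<in>K. (x $ i)\<^sup>2 * ebasis i $ r + x $ i * (1 - x $ i) * ebasis b $ r)"
    if x: "x \<in> prob_simplex" and off: "\<And>r. r \<notin> K \<Longrightarrow> x $ r = 0" for x r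
  proof -
    have row: "(\<Sum>s\<in>UNIV. x $ i * x $ s * (?c i s $ r - ?u $ r)) =
      (x $ i)\<^sup>2 * ebasis i $ r + x $ i * (1 - x $ i) * ebasis b $ r - ?u $ r * x $ i" for i
    proof -
      have "(\<Sum>s\<in>UNIV. x $ i * x $ s * (?c i s $ r - ?u $ r)) =
        (\<Sum>s\<in>UNIV. x $ i * (ebasis b $ r - ?u $ r) * x $ s +
           (if s = i then (x $ i)\<^sup>2 * (ebasis i $ r - ebasis b $ r) else 0))"
        by (intro sum.cong) (auto simp: algebra_simps power2_eq_square simp del: uniform_on_nth)
      also have "\<dots> = x $ i * (ebasis b $ r - ?u $ r) * (\<Sum>s\<in>UNIV. x $ s) +
        (x $ i)\<^sup>2 * (ebasis i $ r - ebasis b $ r)"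
        by (simp add: sum.distrib flip: sum_distrib_left del: uniform_on_nth)
      finally show ?thesis
        using prob_simplex_sum[OF x] by (simp add: algebra_simps power2_eq_square del: uniform_on_nth)
    qed
    have "(\<Sum>(i, s)\<in>K \<times> UNIV. x $ i * x $ s * (?c i s $ r - ?u $ r)) =
      (\<Sum>i\<in>K. \<Sum>s\<in>UNIV. x $ i * x $ s * (?c i s $ r - ?u $ r))"
      by (simp only: sum.cartesian_product)
    also have "\<dots> = (\<Sum>i\<in>K. (x $ i)\<^sup>2 * ebasis i $ r + x $ i * (1 - x $ i) * ebasis b $ r) -
        ?u $ r * (\<Sum>i\<in>K. x $ i)"
      by (simp only: row sum_subtractf sum_distrib_left)
    finally show ?thesis
      using sum_prob_simplex_face[OF x off] by simp
  qed
  show ?thesis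
  proof (intro set_eqI iffI)
    fix x assume stat: "x \<in> stationary_vectors ?Q"
    hence x: "x \<in> prob_simplex"
      by (rule stationary_in_prob_simplex)
    have off: "x $ r = 0" if "r \<notin> K" for r
      using that b by (intro stationary_vanishes[OF stat])
        (auto simp: replace_columns_def constant_tensor_def axis_def)
    have other: "x $ r = (x $ r)\<^sup>2" if "r \<in> K" "r \<noteq> b" for r
    proof -
      have "x $ r = (\<Sum>i\<in>K. (x $ i)\<^sup>2 * ebasis i $ r + x $ i * (1 - x $ i) * ebasis b $ r)"
        using stat deviation[OF x off] unfolding stationary_replace_iff by metis
      also have "\<dots> = (\<Sum>i\<in>K. if i = r then (x $ i)\<^sup>2 else 0)"
        using that by (intro sum.cong) (auto simp: axis_def)
      finally show ?thesis
        using that by (simp add: sum.delta)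
    qed
    \<comment> \<open>If no state other than \<open>b\<close> carries mass, then \<open>b\<close> carries all of it.\<close>
    have "\<exists>j\<in>K. x $ j = 1"
    proof (cases "\<exists>j\<in>K - {b}. x $ j \<noteq> 0")
      case True
      then obtain j where "j \<in> K" "j \<noteq> b" "x $ j \<noteq> 0"
        by auto
      thus ?thesis
        using other[of j] by (auto simp: power2_eq_square)
    next
      case False
      hence "(\<Sum>i\<in>K. x $ i) = x $ b"
        using b by (simp add: sum.remove)
      thus ?thesis
        using sum_prob_simplex_face[OF x off] b by auto
    qed
    thus "x \<in> ebasis ` K"
      using eq_ebasis_if_coordinate_1[OF x] by blast
  next
    fix x :: "real ^ 'a" assume "x \<in> ebasis ` K"
    then obtain j where j: "j \<in> K" and xj: "x = ebasis j"
      by auto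
    have x: "x \<in> prob_simplex"
      using ebasis_in_prob_simplex xj by auto
    have off: "x $ r = 0" if "r \<notin> K" for r
      using that j xj by (auto simp: axis_def)
    have "(\<Sum>i\<in>K. (x $ i)\<^sup>2 * ebasis i $ r + x $ i * (1 - x $ i) * ebasis b $ r) =
        (\<Sum>i\<in>K. if i = j then x $ r else 0)" for r
      unfolding xj by (intro sum.cong) (auto simp: axis_def)
    hence "x $ r = (\<Sum>i\<in>K. (x $ i)\<^sup>2 * ebasis i $ r + x $ i * (1 - x $ i) * ebasis b $ r)" for r
      using j by (simp add: sum.delta)
    thus "x \<in> stationary_vectors ?Q"
      unfolding stationary_replace_iff using deviation[OF x off] x by metis
  qed
qed

text \<open>
  All coordinates solve one quadratic equation, whose two roots sum to 1; a vector in the simplex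
  with two different coordinates has no mass left for a third state, and 0 is therefore a root.
\<close>
lemma stationary_vertices_and_barycenter:
  assumes card: "CARD('n::finite) > 2"
  shows "stationary_vectors
           (replace_columns (constant_tensor (uniform_on UNIV)) {(i, s). s = i} (\<lambda>i s. ebasis i)) =
         range ebasis \<union> {uniform_on UNIV :: real ^ 'n}"
    (is "stationary_vectors ?Q = _")
proof -
  let ?m = "real CARD('n)"
  have diagonal: "(\<Sum>(i, s)\<in>{(i, s). s = i}. f i s) = (\<Sum>i\<in>UNIV. f i i)" for f :: "'n \<Rightarrow> 'n \<Rightarrow> real"
    by (rule sum.reindex_bij_witness[of _ "\<lambda>i. (i, i)" fst]) auto
  have stat_iff: "x \<in> stationary_vectors ?Q \<longleftrightarrow> x \<in> prob_simplex \<and>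
      (\<forall>r. x $ r - (x $ r)\<^sup>2 = (1 - (\<Sum>i\<in>UNIV. (x $ i)\<^sup>2)) / ?m)" for x
  proof -
    have "1 / ?m + (\<Sum>i\<in>UNIV. x $ i * x $ i * (ebasis i $ r - 1 / ?m)) =
        (x $ r)\<^sup>2 + (1 - (\<Sum>i\<in>UNIV. (x $ i)\<^sup>2)) / ?m" for r
    proof -
      have "(\<Sum>i\<in>UNIV. x $ i * x $ i * (ebasis i $ r - 1 / ?m)) =
          (\<Sum>i\<in>UNIV. (if i = r then (x $ i)\<^sup>2 else 0) - (x $ i)\<^sup>2 / ?m)"
        by (intro sum.cong) (auto simp: axis_def power2_eq_square right_diff_distrib)
      also have "\<dots> = (x $ r)\<^sup>2 - (\<Sum>i\<in>UNIV. (x $ i)\<^sup>2) / ?m"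
        by (simp add: sum_subtractf sum_divide_distrib)
      finally show ?thesis
        by (simp add: diff_divide_distrib)
    qed
    thus ?thesis
      by (simp add: stationary_replace_iff diagonal algebra_simps)
  qed
  show ?thesis
  proof (intro set_eqI iffI)
    fix x assume stat: "x \<in> stationary_vectors ?Q"
    hence x: "x \<in> prob_simplex"
      by (simp add: stat_iff)
    \<comment> \<open>The common value of \<open>x\<^sub>r - x\<^sub>r\<^sup>2\<close>.\<close>
    define d where "d = (1 - (\<Sum>i\<in>UNIV. (x $ i)\<^sup>2)) / ?m"
    have root: "x $ r - (x $ r)\<^sup>2 = d" for r
      using stat by (simp add: stat_iff d_def)
    show "x \<in> range ebasis \<union> {uniform_on UNIV}"
    proof (cases "\<exists>a b. x $ a \<noteq> x $ b")
      case True
      then obtain a b where ab: "x $ a \<noteq> x $ b"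
        by auto
      have "(x $ a - x $ b) * (x $ a + x $ b - 1) = 0"
        using root[of a] root[of b] by (simp add: power2_eq_square algebra_simps)
      hence ab1: "x $ a + x $ b = 1"
        using ab by simp
      have "a \<noteq> b"
        using ab by auto
      have "card {a, b} \<le> 2"
        by (simp add: card_insert_if)
      hence "{a, b} \<noteq> UNIV"
        using card by auto
      then obtain c where c: "c \<noteq> a" "c \<noteq> b"
        by auto
      have "(\<Sum>i\<in>{a, b, c}. x $ i) \<le> (\<Sum>i\<in>UNIV. x $ i)"
        using prob_simplex_nonneg[OF x] by (intro sum_mono2) auto
      moreover have "(\<Sum>i\<in>{a, b, c}. x $ i) = x $ a + (x $ b + x $ c)"
        using c \<open>a \<noteq> b\<close> by auto
      ultimately have "x $ c = 0"
        using prob_simplex_sum[OF x] ab1 prob_simplex_nonneg[OF x, of c] by linarith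
      hence "d = 0"
        using root[of c] by simp
      hence "x $ r = 0 \<or> x $ r = 1" for r
        using root[of r] by (simp add: power2_eq_square)
      thus ?thesis
        using eq_ebasis_if_coordinates_0_1[OF x] by blast
    next
      case False
      hence "(\<Sum>i\<in>UNIV. x $ i) = (\<Sum>i\<in>(UNIV :: 'n set). x $ r)" for r
        by (intro sum.cong) auto
      hence "?m * x $ r = 1" for r
        using prob_simplex_sum[OF x] by simp
      hence "x = uniform_on UNIV"
        by (simp add: vec_eq_iff field_simps)
      thus ?thesis
        by simp
    qed
  next
    fix x :: "real ^ 'n" assume "x \<in> range ebasis \<union> {uniform_on UNIV}"
    then consider j where "x = ebasis j" | "x = uniform_on UNIV"
      by auto
    thus "x \<in> stationary_vectors ?Q"
    proof cases
      case 1
      have "(\<Sum>i\<in>UNIV. (x $ i)\<^sup>2) = 1"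
        unfolding 1 by (simp add: axis_def if_distrib[of "\<lambda>y. y\<^sup>2"] cong: if_cong)
      thus ?thesis
        using ebasis_in_prob_simplex[of j] unfolding stat_iff by (simp add: 1 axis_def)
    next
      case 2
      thus ?thesis
        using uniform_on_in_prob_simplex[of "UNIV :: 'n set"]
        by (simp add: stat_iff power2_eq_square field_simps)
    qed
  qed
qed

section \<open>Chains with a face of stationary vectors\<close>

text \<open>
  On the face, a pair \<open>(i, s)\<close> moves to its own component \<open>i\<close>, so state \<open>r\<close> receives
  \<open>x\<^sub>r (\<Sum>s\<in>K. x\<^sub>s) = x\<^sub>r\<close>.
\<close>
lemma stationary_face:
  assumes "K \<noteq> {}"
  shows "stationary_vectors
           (replace_columns (constant_tensor (uniform_on K)) (K \<times> K) (\<lambda>i s. ebasis i)) =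
         convex hull (ebasis ` K)"
    (is "stationary_vectors ?Q = _")
proof -
  let ?u = "uniform_on K :: real ^ 'a"
  have off: "x $ r = 0" if "x \<in> stationary_vectors ?Q" "r \<notin> K" for x r
    using that(2) by (intro stationary_vanishes[OF that(1)])
      (auto simp: replace_columns_def constant_tensor_def axis_def)
  have "x \<in> stationary_vectors ?Q"
    if x: "x \<in> prob_simplex" and 0: "\<And>r. r \<notin> K \<Longrightarrow> x $ r = 0" for x
  proof -
    have "x $ r = ?u $ r + (\<Sum>(i, s)\<in>K \<times> K. x $ i * x $ s * (ebasis i $ r - ?u $ r))" for r
    proof -
      have "(\<Sum>(i, s)\<in>K \<times> K. x $ i * x $ s * (ebasis i $ r - ?u $ r)) =
        (\<Sum>i\<in>K. x $ i * (ebasis i $ r - ?u $ r) * (\<Sum>s\<in>K. x $ s))"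
        by (simp add: sum_distrib_left sum_distrib_right mult_ac flip: sum.cartesian_product
            del: uniform_on_nth)
      also have "\<dots> = (\<Sum>i\<in>K. (if i = r then x $ i else 0) - ?u $ r * x $ i)"
        using sum_prob_simplex_face[OF x 0]
        by (intro sum.cong) (auto simp: axis_def algebra_simps simp del: uniform_on_nth)
      also have "\<dots> = x $ r - ?u $ r * (\<Sum>i\<in>K. x $ i)"
        using 0 by (auto simp: sum_subtractf sum_distrib_left simp del: uniform_on_nth)
      finally show ?thesis
        using sum_prob_simplex_face[OF x 0] by simp
    qed
    thus ?thesis
      using x unfolding stationary_replace_iff by blast
  qed
  thus ?thesis
    unfolding convex_hull_ebasis using off stationary_in_prob_simplex by blast
qed

text \<open>
  Only the mass \<open>t\<close> on \<open>K\<close> couples the equations: with weight \<open>t\<close> the columns \<open>v\<^sub>i\<close> reproduce \<open>x\<close>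
  on \<open>K\<close> and spread the mass \<open>1 - t\<close> uniformly off \<open>K\<close>, and with weight \<open>1 - t\<close> the columns are
  uniform on all states.
\<close>
lemma stationary_face_and_barycenter:
  fixes K :: "'n::finite set"
  assumes K: "K \<noteq> {}" "K \<noteq> UNIV"
  shows "stationary_vectors
           (replace_columns P UNIV
             (\<lambda>i s. if s \<in> K then (if i \<in> K then ebasis i else uniform_on (- K))
                    else uniform_on UNIV)) =
         {uniform_on UNIV} \<union> convex hull (ebasis ` K)"
    (is "stationary_vectors ?Q = _")
proof -
  let ?u = "uniform_on UNIV :: real ^ 'n"
  let ?v = "\<lambda>i. if i \<in> K then ebasis i else uniform_on (- K) :: real ^ 'n"
  let ?n = "real CARD('n)" and ?k = "real (card K)"
  have card_Compl: "real (card (- K)) = ?n - ?k"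
    by (simp add: Compl_eq_Diff_UNIV card_Diff_subset of_nat_diff card_mono)
  have kn: "?k < ?n"
    using K by (simp add: psubset_card_mono psubsetI)
  \<comment> \<open>Viewed from the uniform chain, only the columns in \<open>K\<close> deviate.\<close>
  have Q: "?Q = replace_columns (constant_tensor ?u) (UNIV \<times> K) (\<lambda>i s. ?v i)"
    by (auto simp: replace_columns_def constant_tensor_def fun_eq_iff)
  have stat_iff: "x \<in> stationary_vectors ?Q \<longleftrightarrow> x \<in> prob_simplex \<and>
      (\<forall>r. x $ r = (1 - (\<Sum>i\<in>K. x $ i)) / ?n + (\<Sum>i\<in>K. x $ i) *
         (if r \<in> K then x $ r else (1 - (\<Sum>i\<in>K. x $ i)) / (?n - ?k)))" for x
  proof -
    have "?u $ r + (\<Sum>(i, s)\<in>UNIV \<times> K. x $ i * x $ s * (?v i $ r - ?u $ r)) =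
        (1 - (\<Sum>i\<in>K. x $ i)) / ?n + (\<Sum>i\<in>K. x $ i) *
         (if r \<in> K then x $ r else (1 - (\<Sum>i\<in>K. x $ i)) / (?n - ?k))"
      if x: "x \<in> prob_simplex" for r
    proof -
      have split: "(\<Sum>i\<in>UNIV. f i) = (\<Sum>i\<in>K. f i) + (\<Sum>i\<in>- K. f i)" for f :: "'n \<Rightarrow> real"
        using sum.union_disjoint[of K "- K" f] by simp
      have inside: "(\<Sum>i\<in>K. x $ i * ?v i $ r) = (if r \<in> K then x $ r else 0)"
      proof -
        have "(\<Sum>i\<in>K. x $ i * ?v i $ r) = (\<Sum>i\<in>K. if i = r then x $ i else 0)"
          by (intro sum.cong) (auto simp: axis_def)
        thus ?thesis
          by (simp add: sum.delta)
      qed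
      have "(\<Sum>i\<in>- K. x $ i * ?v i $ r) = (\<Sum>i\<in>- K. x $ i) * uniform_on (- K) $ r"
        unfolding sum_distrib_right by (intro sum.cong) auto
      also have "(\<Sum>i\<in>- K. x $ i) = 1 - (\<Sum>i\<in>K. x $ i)"
        using split[of "\<lambda>i. x $ i"] prob_simplex_sum[OF x] by simp
      finally have mean: "(\<Sum>i\<in>UNIV. x $ i * ?v i $ r) =
          (if r \<in> K then x $ r else (1 - (\<Sum>i\<in>K. x $ i)) / (?n - ?k))"
        unfolding split[of "\<lambda>i. x $ i * ?v i $ r"] inside by (simp add: card_Compl)
      have "(\<Sum>(i, s)\<in>UNIV \<times> K. x $ i * x $ s * (?v i $ r - ?u $ r)) =
          (\<Sum>i\<in>UNIV. \<Sum>s\<in>K. x $ i * x $ s * (?v i $ r - ?u $ r))"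
        by (simp only: sum.cartesian_product)
      also have "\<dots> = (\<Sum>i\<in>UNIV. (x $ i * ?v i $ r - ?u $ r * x $ i) * (\<Sum>s\<in>K. x $ s))"
        unfolding sum_distrib_left by (intro sum.cong) (auto simp: algebra_simps simp del: uniform_on_nth)
      also have "\<dots> = ((\<Sum>i\<in>UNIV. x $ i * ?v i $ r) - ?u $ r * (\<Sum>i\<in>UNIV. x $ i)) * (\<Sum>s\<in>K. x $ s)"
        unfolding sum_distrib_right[symmetric] by (simp only: sum_subtractf sum_distrib_left)
      finally show ?thesis
        unfolding mean prob_simplex_sum[OF x] by (simp add: algebra_simps diff_divide_distrib)
    qed
    thus ?thesis
      unfolding Q stationary_replace_iff by (metis (no_types, lifting))
  qed
  show ?thesis
  proof (intro set_eqI iffI)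
    fix x assume stat: "x \<in> stationary_vectors ?Q"
    hence x: "x \<in> prob_simplex"
      by (simp add: stat_iff)
    define t where "t = (\<Sum>i\<in>K. x $ i)"
    have eq: "x $ r = (1 - t) / ?n + t * (if r \<in> K then x $ r else (1 - t) / (?n - ?k))" for r
      using stat unfolding stat_iff t_def by blast
    show "x \<in> {?u} \<union> convex hull (ebasis ` K)"
    proof (cases "t = 1")
      case True
      hence "x $ r = 0" if "r \<notin> K" for r
        using eq[of r] that by simp
      thus ?thesis
        using x by (simp add: convex_hull_ebasis)
    next
      case False
      have in_K: "x $ r = 1 / ?n" if "r \<in> K" for r
      proof -
        have "(1 - t) * x $ r = (1 - t) * (1 / ?n)"
          using eq[of r] that by (simp add: algebra_simps)
        thus ?thesis
          using False by (metis mult_cancel_left right_minus_eq)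
      qed
      hence t: "t = ?k / ?n"
        by (simp add: t_def)
      have "x $ r = 1 / ?n" if "r \<notin> K" for r
      proof -
        have "x $ r = (1 - ?k / ?n) / ?n + ?k / ?n * ((1 - ?k / ?n) / (?n - ?k))"
          using eq[of r] that by (simp add: t)
        also have "1 - ?k / ?n = (?n - ?k) / ?n"
          by (simp add: field_simps)
        also have "(?n - ?k) / ?n / ?n + ?k / ?n * ((?n - ?k) / ?n / (?n - ?k)) = 1 / ?n"
          using kn by (simp add: field_simps)
        finally show ?thesis .
      qed
      thus ?thesis
        using in_K by (auto simp: vec_eq_iff)
    qed
  next
    fix x :: "real ^ 'n" assume "x \<in> {?u} \<union> convex hull (ebasis ` K)"
    then consider "x = ?u" | "x \<in> prob_simplex" "\<And>r. r \<notin> K \<Longrightarrow> x $ r = 0"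
      by (auto simp: convex_hull_ebasis)
    thus "x \<in> stationary_vectors ?Q"
    proof cases
      case 1
      have "1 - ?k / ?n = (?n - ?k) / ?n"
        by (simp add: field_simps)
      moreover have "(?n - ?k) / ?n / ?n + ?k / ?n * ((?n - ?k) / ?n / (?n - ?k)) = 1 / ?n"
        using kn by (simp add: field_simps)
      moreover have "(?n - ?k) / ?n / ?n + ?k / ?n * (1 / ?n) = 1 / ?n"
        by (simp add: field_simps)
      ultimately show ?thesis
        using uniform_on_in_prob_simplex[of "UNIV :: 'n set"] by (auto simp: 1 stat_iff)
    next
      case 2
      thus ?thesis
        using sum_prob_simplex_face[OF 2] by (auto simp: stat_iff)
    qed
  qed
qed

section \<open>The base chain and its modifications\<close>

theorem theorem2p3:
  fixes n k :: nat
    and en :: "nat \<Rightarrow> 'n::finite"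
    and P :: "'n tensor"
  assumes "n = CARD('n)" and "n > 2"
    and "bij_betw en {1..n} UNIV"
    and "k \<in> {1..n}"
    and "transition_tensor P"
    and "\<forall>i s. column s (slice P i) = fvec en k"
  shows "stationary_vectors P = {fvec en k} \<and>
    (k = 2 \<longrightarrow>
      (let Q = replace_columns
                 (replace_columns P {(en 1, en 1)} (\<lambda>i s. ebasis (en 1)))
                 ({en 2} \<times> UNIV) (\<lambda>i s. ebasis (en 2))
       in transition_tensor Q \<and>
          card (stationary_vectors Q) = 2 \<and>
          stationary_vectors Q = {ebasis (en 1), ebasis (en 2)})) \<and>
    (2 < k \<and> k \<le> n \<longrightarrow>
      (let Q = replace_columns P (en ` {1..k} \<times> UNIV)
                 (\<lambda>i s. if s = i then ebasis i else ebasis (en k))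
       in transition_tensor Q \<and>
          card (stationary_vectors Q) = k \<and>
          stationary_vectors Q = (\<lambda>j. ebasis (en j)) ` {1..k})) \<and>
    (k = n \<longrightarrow>
      (let Q = replace_columns P {(i, s). s = i} (\<lambda>i s. ebasis i)
       in transition_tensor Q \<and>
          card (stationary_vectors Q) = n + 1 \<and>
          stationary_vectors Q = (\<lambda>j. ebasis (en j)) ` {1..n} \<union> {fvec en n})) \<and>
    (k \<in> {2..n - 1} \<longrightarrow>
      (let Q = replace_columns P (en ` {1..k} \<times> en ` {1..k}) (\<lambda>i s. ebasis i)
       in transition_tensor Q \<and>
          stationary_vectors Q = convex hull ((\<lambda>j. ebasis (en j)) ` {1..k}))) \<and>
    (k \<in> {2..n - 1} \<longrightarrow>
      (let v = (\<lambda>i. if i \<in> en ` {1..k} then ebasis i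
                    else (\<Sum>j=k+1..n. ebasis (en j)) /\<^sub>R (real n - real k));
           Q = replace_columns P UNIV
                 (\<lambda>i s. if s \<in> en ` {1..k} then v i else fvec en n)
       in transition_tensor Q \<and>
          stationary_vectors Q =
            {fvec en n} \<union> convex hull ((\<lambda>j. ebasis (en j)) ` {1..k})))"
proof -
  let ?K = "en ` {1..k}"
  have K: "?K \<noteq> {}"
    using assms(4) by auto
  have inj: "inj_on en {1..n}" and surj: "en ` {1..n} = UNIV"
    using assms(3) by (auto simp: bij_betw_def)
  have inj_k: "inj_on en {1..k}"
    using inj assms(4) by (auto intro: inj_on_subset)
  have fvec: "fvec en m = uniform_on (en ` {1..m})" if "m \<le> n" for m
    using mean_of_ebasis_eq_uniform_on[of en "{1..m}"] inj_on_subset[OF inj, of "{1..m}"] that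
    by (simp add: fvec_def)
  have fk: "fvec en k = uniform_on ?K" and fn: "fvec en n = uniform_on UNIV"
    using fvec[of k] fvec[of n] assms(4) surj by auto
  have P: "P = constant_tensor (uniform_on ?K)"
    using assms(6) by (auto simp: fk constant_tensor_def fun_eq_iff column_def slice_def vec_eq_iff)
  have simplices: "uniform_on ?K \<in> prob_simplex" "uniform_on (UNIV :: 'n set) \<in> prob_simplex"
    using K by (auto intro!: uniform_on_in_prob_simplex)
  have inj_ebasis: "inj (ebasis :: 'n \<Rightarrow> real ^ 'n)"
    by (auto simp: inj_def axis_eq_axis)
  have vertices: "(\<lambda>j. ebasis (en j)) ` J = ebasis ` en ` J" for J
    by auto
  have card_vertices: "card (ebasis ` L :: (real ^ 'n) set) = card L" for L
    using inj_ebasis by (auto intro: card_image inj_on_subset)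
  have base: "stationary_vectors P = {fvec en k}"
    unfolding P fk using simplices by (intro stationary_constant)

  have part1: "let Q = replace_columns
                 (replace_columns P {(en 1, en 1)} (\<lambda>i s. ebasis (en 1)))
                 ({en 2} \<times> UNIV) (\<lambda>i s. ebasis (en 2))
       in transition_tensor Q \<and>
          card (stationary_vectors Q) = 2 \<and>
          stationary_vectors Q = {ebasis (en 1), ebasis (en 2)}" if "k = 2"
  proof -
    have "?K = {en 1, en 2}"
      using that by (auto simp: numeral_2_eq_2 atLeastAtMostSuc_conv)
    moreover have neq: "en 1 \<noteq> en 2"
      using inj_onD[OF inj, of 1 2] assms(2) by auto
    ultimately have "stationary_vectors (replace_columns
                 (replace_columns P {(en 1, en 1)} (\<lambda>i s. ebasis (en 1)))
                 ({en 2} \<times> UNIV) (\<lambda>i s. ebasis (en 2))) = {ebasis (en 1), ebasis (en 2)}"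
      using stationary_two_vertices[of "en 1" "en 2"] by (simp add: P)
    thus ?thesis
      using assms(5) neq
      by (auto simp: Let_def axis_eq_axis
          intro!: transition_tensor_replace_columns ebasis_in_prob_simplex)
  qed

  have part2: "let Q = replace_columns P (?K \<times> UNIV)
                 (\<lambda>i s. if s = i then ebasis i else ebasis (en k))
       in transition_tensor Q \<and>
          card (stationary_vectors Q) = k \<and>
          stationary_vectors Q = (\<lambda>j. ebasis (en j)) ` {1..k}"
  proof -
    have "en k \<in> ?K"
      using assms(4) by auto
    hence "stationary_vectors (replace_columns P (?K \<times> UNIV)
        (\<lambda>i s. if s = i then ebasis i else ebasis (en k))) = ebasis ` ?K"
      unfolding P by (rule stationary_vertices)
    thus ?thesis
      unfolding vertices using assms(5) inj_k
      by (auto simp: Let_def card_vertices card_image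
          intro!: transition_tensor_replace_columns ebasis_in_prob_simplex)
  qed

  have part3: "let Q = replace_columns P {(i, s). s = i} (\<lambda>i s. ebasis i)
       in transition_tensor Q \<and>
          card (stationary_vectors Q) = n + 1 \<and>
          stationary_vectors Q = (\<lambda>j. ebasis (en j)) ` {1..n} \<union> {fvec en n}" if "k = n"
  proof -
    have "?K = UNIV"
      using that surj by simp
    hence eq: "stationary_vectors (replace_columns P {(i, s). s = i} (\<lambda>i s. ebasis i)) =
        range ebasis \<union> {uniform_on UNIV}"
      using stationary_vertices_and_barycenter assms(1,2) by (simp add: P)
    have "uniform_on UNIV \<noteq> (ebasis j :: real ^ 'n)" for j
    proof
      assume "uniform_on UNIV = (ebasis j :: real ^ 'n)"
      hence "uniform_on UNIV $ j = (ebasis j :: real ^ 'n) $ j"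
        by simp
      thus False
        using assms(1,2) by (simp add: axis_def)
    qed
    hence "card (range ebasis \<union> {uniform_on UNIV :: real ^ 'n}) = n + 1"
      using card_vertices[of UNIV] assms(1) by (subst card_Un_disjoint) auto
    thus ?thesis
      unfolding vertices surj fn Let_def eq using assms(5)
      by (auto intro!: transition_tensor_replace_columns ebasis_in_prob_simplex)
  qed

  have part4: "let Q = replace_columns P (?K \<times> ?K) (\<lambda>i s. ebasis i)
       in transition_tensor Q \<and>
          stationary_vectors Q = convex hull ((\<lambda>j. ebasis (en j)) ` {1..k})"
    unfolding vertices Let_def using assms(5) stationary_face[OF K]
    by (auto simp: P intro!: transition_tensor_replace_columns ebasis_in_prob_simplex)

  have part5: "let v = (\<lambda>i. if i \<in> ?K then ebasis i
                    else (\<Sum>j=k+1..n. ebasis (en j)) /\<^sub>R (real n - real k));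
           Q = replace_columns P UNIV (\<lambda>i s. if s \<in> ?K then v i else fvec en n)
       in transition_tensor Q \<and>
          stationary_vectors Q =
            {fvec en n} \<union> convex hull ((\<lambda>j. ebasis (en j)) ` {1..k})" if k: "k \<in> {2..n - 1}"
  proof -
    have "en ` ({1..n} - {1..k}) = en ` {1..n} - ?K"
      using k by (intro inj_on_image_set_diff[OF inj]) auto
    moreover have "{1..n} - {1..k} = {k+1..n}"
      by auto
    ultimately have Compl: "en ` {k+1..n} = - ?K"
      using surj by auto
    have "k \<le> n"
      using k by auto
    hence card_Compl: "real (n - k) = real n - real k"
      by (rule of_nat_diff)
    have mean: "(\<Sum>j=k+1..n. ebasis (en j)) /\<^sub>R (real n - real k) = uniform_on (- ?K)"
      using mean_of_ebasis_eq_uniform_on[of en "{k+1..n}"] inj_on_subset[OF inj, of "{k+1..n}"]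
        card_Compl
      by (simp add: Compl[simplified])
    have "- ?K \<noteq> {}"
      unfolding Compl[symmetric] using k by auto
    hence "uniform_on (- ?K) \<in> prob_simplex" and "?K \<noteq> UNIV"
      using uniform_on_in_prob_simplex[of "- ?K"] by auto
    thus ?thesis
      unfolding Let_def fn mean vertices
      using assms(5) simplices(2) stationary_face_and_barycenter[OF K]
      by (intro conjI transition_tensor_replace_columns) (simp_all add: ebasis_in_prob_simplex)
  qed

  show ?thesis
    using base part1 part2 part3 part4 part5 by blast
qed

end
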